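(* Let $z=(x,\lambda,\mu_L,\mu_R)\in\mathcal{N}(\tau)$, where $0<\tau\le\tau_E$. Then $x$ satisfies $$x\in\Omega,\qquad q(x)\le q(x^\star)+\mathrm{tol},\qquad\|Ax-b\|_2\le\chi+\mathrm{tol}.$$
   Context: $n,m\ge1$; $Q\in\mathbb{R}^{n\times n}$ symmetric positive semidefinite, $c\in\mathbb{R}^n$, $A\in\mathbb{R}^{m\times n}$, $b\in\mathbb{R}^m$, $\mathrm{tol}>0$; $q(x)=\frac12x^{\mathsf T}Qx+c^{\mathsf T}x$; $\Omega=\{\xi\in\mathbb{R}^n:\|\xi\|_\infty<1\}$; $\chi=\min_{\xi\in\overline\Omega}\|A\xi-b\|_2$; $x^\star$ is any minimizer of $q(x)$ subject to $\|Ax-b\|_2=\chi$, $\|x\|_\infty\le1$. $\mathbf 1$ is the all-ones vector; products of vectors of equal length are componentwise; $\|\cdot\|_2$ is the Euclidean/spectral norm. Method parameters: positive reals satisfying (an upper bound with zero denominator is vacuous) $\theta\le0.3$; $C_q\ge\|Q\|_2n+\|c\|_2\sqrt n$; $\omega\le\min\{\frac{\mathrm{tol}}{2n},\frac{\mathrm{tol}^2}{16(4C_q+n)},1\}$; $\tau_E\le\frac{\mathrm{tol}^2\omega}{48n\max\{\|A\|_2,C_q\}^2}$. For $z=(x,\lambda,\mu_L,\mu_R)\in\mathbb{R}^n\times\mathbb{R}^m\times\mathbb{R}^n\times\mathbb{R}^n$ and $\tau>0$: $$F_\tau(z)=\begin{pmatrix}Qx+\omega x+c-A^{\mathsf T}\lambda-\mu_L+\mu_R\\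 Ax-b+\omega\lambda\\ \mu_L\cdot(\mathbf 1+x)-\tau\mathbf 1\\ \mu_R\cdot(\mathbf 1-x)-\tau\mathbf 1\end{pmatrix}.$$ $\mathcal{N}(\tau)$ is the set of $z$ with $F_\tau(z)=(0_n,0_m,r^{(3)},r^{(4)})$, $\|(r^{(3)},r^{(4)})\|_2\le\theta\tau$, $\|x\|_\infty<1$, $\mu_L>0$, $\mu_R>0$ (componentwise). *)

theory Defs
  imports "HOL-Analysis.Analysis"
begin

definition Omega :: "(real ^ 'n) set" where
  "Omega = {\<xi>. infnorm \<xi> < 1}"

definition quad_obj :: "real ^ 'n ^ 'n \<Rightarrow> real ^ 'n \<Rightarrow> real ^ 'n \<Rightarrow> real" where
  "quad_obj Q c x = (1 / 2) * (x \<bullet> (Q *v x)) + c \<bullet> x"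

definition pos_semidef :: "real ^ 'n ^ 'n \<Rightarrow> bool" where
  "pos_semidef Q \<longleftrightarrow> (\<forall>v. 0 \<le> v \<bullet> (Q *v v))"

definition spectral_norm :: "real ^ 'n ^ 'm \<Rightarrow> real" where
  "spectral_norm A = onorm ((*v) A)"

text \<open>The infimum below is attained, i.e. it is a minimum; see \<open>chi_attained\<close> and \<open>chi_le\<close>.\<close>

definition chi :: "real ^ 'n ^ 'm \<Rightarrow> real ^ 'm \<Rightarrow> real" where
  "chi A b = (INF \<xi>\<in>closure Omega. norm (A *v \<xi> - b))"

text \<open>On vectors, \<open>*\<close> is the componentwise product and \<open>1\<close> is the all-ones vector.\<close>

definition KKT_map ::
  "real ^ 'n ^ 'n \<Rightarrow> real ^ 'n \<Rightarrow> real ^ 'n ^ 'm \<Rightarrow> real ^ 'm \<Rightarrow> real \<Rightarrow> real \<Rightarrow>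
   (real ^ 'n) \<times> (real ^ 'm) \<times> (real ^ 'n) \<times> (real ^ 'n) \<Rightarrow>
   (real ^ 'n) \<times> (real ^ 'm) \<times> (real ^ 'n) \<times> (real ^ 'n)" where
  "KKT_map Q c A b \<omega> \<tau> = (\<lambda>(x, l, \<mu>L, \<mu>R).
     (Q *v x + \<omega> *\<^sub>R x + c - transpose A *v l - \<mu>L + \<mu>R,
      A *v x - b + \<omega> *\<^sub>R l,
      \<mu>L * (1 + x) - \<tau> *\<^sub>R 1,
      \<mu>R * (1 - x) - \<tau> *\<^sub>R 1))"

text \<open>The norm of the pair \<open>(r3, r4)\<close> is the Euclidean norm of the concatenated vector
  (\<open>norm_prod_def\<close>). Strict positivity is spelled out because \<open><\<close> on vectors is not the
  componentwise strict order.\<close>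

definition central_nbhd ::
  "real ^ 'n ^ 'n \<Rightarrow> real ^ 'n \<Rightarrow> real ^ 'n ^ 'm \<Rightarrow> real ^ 'm \<Rightarrow> real \<Rightarrow> real \<Rightarrow> real \<Rightarrow>
   ((real ^ 'n) \<times> (real ^ 'm) \<times> (real ^ 'n) \<times> (real ^ 'n)) set" where
  "central_nbhd Q c A b \<omega> \<theta> \<tau> = {(x, l, \<mu>L, \<mu>R).
     (\<exists>r3 r4. KKT_map Q c A b \<omega> \<tau> (x, l, \<mu>L, \<mu>R) = (0, 0, r3, r4) \<and>
        norm (r3, r4) \<le> \<theta> * \<tau>) \<and>
     infnorm x < 1 \<and> (\<forall>i. 0 < \<mu>L $ i) \<and> (\<forall>i. 0 < \<mu>R $ i)}"

lemma compact_closure_Omega: "compact (closure (Omega :: (real ^ 'n) set))"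
proof -
  have "norm x \<le> sqrt (real DIM(real ^ 'n))" if "x \<in> Omega" for x :: "real ^ 'n"
  proof -
    have "sqrt (real DIM(real ^ 'n)) * infnorm x \<le> sqrt (real DIM(real ^ 'n)) * 1"
      using that by (intro mult_left_mono) (auto simp: Omega_def)
    then show ?thesis
      using norm_le_infnorm[of x] by linarith
  qed
  then have "bounded (Omega :: (real ^ 'n) set)"
    unfolding bounded_iff by blast
  then show ?thesis
    by (simp add: compact_closure)
qed

lemma chi_le:
  assumes "\<xi> \<in> closure Omega"
  shows "chi A b \<le> norm (A *v \<xi> - b)"
  unfolding chi_def using assms by (intro cINF_lower bdd_belowI2[of _ 0]) auto

lemma chi_attained: "\<exists>\<xi>\<in>closure Omega. chi A b = norm (A *v \<xi> - b)"
proof -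
  have "0 \<in> (Omega :: (real ^ 'n) set)"
    by (simp add: Omega_def infnorm_0)
  then have ne: "closure (Omega :: (real ^ 'n) set) \<noteq> {}"
    by auto
  have cont: "continuous_on (closure Omega) (\<lambda>\<xi>. norm (A *v \<xi> - b))"
    by (intro continuous_intros linear_continuous_on matrix_vector_mul_bounded_linear)
  obtain \<xi> where \<xi>: "\<xi> \<in> closure Omega"
    "\<And>\<eta>. \<eta> \<in> closure Omega \<Longrightarrow> norm (A *v \<xi> - b) \<le> norm (A *v \<eta> - b)"
    using continuous_attains_inf[OF compact_closure_Omega ne cont] by blast
  have "norm (A *v \<xi> - b) \<le> chi A b"
    unfolding chi_def using \<xi>(2) ne by (intro cINF_greatest) auto
  then have "chi A b = norm (A *v \<xi> - b)"
    using chi_le[OF \<xi>(1)] by (rule antisym[rotated])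
  then show ?thesis
    using \<xi>(1) by blast
qed

end

theory Submission
  imports Defs
begin

text \<open>Eliminating \<open>l = (b - A x) / \<omega>\<close> shows that \<open>F\<^sub>\<tau>(z) = (0, 0, r3, r4)\<close> is a perturbed
  optimality system for the strictly convex problem of minimizing
  \<open>P y = q y + \<omega> / 2 * \<parallel>y\<parallel>\<^sup>2 + \<parallel>A y - b\<parallel>\<^sup>2 / (2 \<omega>)\<close>
  over the box: the gradient of \<open>P\<close> at \<open>x\<close> is \<open>\<mu>L - \<mu>R\<close>. Since \<open>\<mu>L, \<mu>R\<close> are positive, \<open>P\<close> is convex
  and the complementarity products are close to \<open>\<tau>\<close>, the point \<open>x\<close> minimizes \<open>P\<close> over the box up
  to an additive error \<open>\<epsilon> = 5/2 n \<tau>\<close> (\<open>penalized_obj_near_minimal\<close>).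

  Comparing with \<open>y = xstar\<close>, whose residual is \<open>\<chi>\<close>, gives both bounds. As the residual of \<open>x\<close> is
  at least \<open>\<chi>\<close>, the objective gap is at most \<open>\<omega> n / 2 + \<epsilon>\<close>. As \<open>q\<close> lies between \<open>- C\<^sub>q\<close> and
  \<open>C\<^sub>q\<close> on the box, the squared residual exceeds \<open>\<chi>\<^sup>2\<close> by at most
  \<open>4 \<omega> C\<^sub>q + \<omega>\<^sup>2 n + 2 \<omega> \<epsilon>\<close>. The bounds on \<open>\<omega>\<close>
  make all terms without \<open>\<epsilon>\<close> small enough.

  The bound on \<open>\<tau>\<close> controls \<open>\<epsilon>\<close> only if \<open>tol\<close> is not too large compared with the data. This costs
  nothing: the objective bound is trivial when \<open>2 C\<^sub>q \<le> tol\<close>, and the residual bound is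
  trivial when \<open>2 \<parallel>A\<parallel> \<surd>n \<le> tol\<close>. Otherwise \<open>\<epsilon> \<le> \<omega> / 4\<close> in the first case and
  \<open>\<epsilon> \<le> n \<omega> / 4\<close> in the second.\<close>

section \<open>The penalized objective and its convexity\<close>

text \<open>The objective of the box-constrained problem left after eliminating \<open>l\<close>: a proximal term and a
  quadratic penalty for \<open>A y = b\<close> are added to the quadratic objective.\<close>

definition penalized_obj ::
  "real ^ 'n ^ 'n \<Rightarrow> real ^ 'n \<Rightarrow> real ^ 'n ^ 'm \<Rightarrow> real ^ 'm \<Rightarrow> real \<Rightarrow> real ^ 'n \<Rightarrow> real" where
  "penalized_obj Q c A b \<omega> y =
     quad_obj Q c y + \<omega> / 2 * (norm y)\<^sup>2 + (norm (A *v y - b))\<^sup>2 / (2 * \<omega>)"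

lemma quad_obj_above_tangent:
  fixes Q :: "real ^ 'n ^ 'n"
  assumes "transpose Q = Q" and "pos_semidef Q"
  shows "quad_obj Q c x + (Q *v x + c) \<bullet> (y - x) \<le> quad_obj Q c y"
proof -
  have sym: "x \<bullet> (Q *v y) = y \<bullet> (Q *v x)"
    by (metis assms(1) dot_lmul_matrix inner_commute transpose_matrix_vector)
  have "0 \<le> (y - x) \<bullet> (Q *v (y - x))"
    using assms(2) by (simp add: pos_semidef_def)
  also have "\<dots> = y \<bullet> (Q *v y) - 2 * (y \<bullet> (Q *v x)) + x \<bullet> (Q *v x)"
    by (simp add: matrix_vector_mult_diff_distrib inner_diff_left inner_diff_right sym)
  finally show ?thesis
    by (simp add: quad_obj_def inner_add_left inner_diff_right inner_commute[of "Q *v x"])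
qed

lemma norm_square_above_tangent:
  fixes v w :: "'a :: real_inner"
  shows "(norm v)\<^sup>2 + 2 * (v \<bullet> (w - v)) \<le> (norm w)\<^sup>2"
proof -
  have "0 \<le> (w - v) \<bullet> (w - v)"
    by simp
  then show ?thesis
    by (simp add: power2_norm_eq_inner inner_diff_left inner_diff_right inner_commute)
qed

lemma penalized_obj_above_tangent:
  fixes Q :: "real ^ 'n ^ 'n" and A :: "real ^ 'n ^ 'm"
  assumes "transpose Q = Q" and "pos_semidef Q" and "0 < \<omega>"
  shows "penalized_obj Q c A b \<omega> x
      + (Q *v x + \<omega> *\<^sub>R x + c + (1 / \<omega>) *\<^sub>R (transpose A *v (A *v x - b))) \<bullet> (y - x)
    \<le> penalized_obj Q c A b \<omega> y"
proof -
  have adj: "(transpose A *v (A *v x - b)) \<bullet> (y - x) = (A *v x - b) \<bullet> (A *v y - b - (A *v x - b))"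
    unfolding transpose_matrix_vector dot_lmul_matrix by (simp add: matrix_vector_mult_diff_distrib)
  have "\<omega> / 2 * ((norm x)\<^sup>2 + 2 * (x \<bullet> (y - x))) \<le> \<omega> / 2 * (norm y)\<^sup>2"
    using assms(3) norm_square_above_tangent[of x y] by (intro mult_left_mono) auto
  then have 1: "\<omega> / 2 * (norm x)\<^sup>2 + \<omega> * (x \<bullet> (y - x)) \<le> \<omega> / 2 * (norm y)\<^sup>2"
    by (simp add: distrib_left)
  define t where "t = (transpose A *v (A *v x - b)) \<bullet> (y - x)"
  have "((norm (A *v x - b))\<^sup>2 + 2 * t) / (2 * \<omega>) \<le> (norm (A *v y - b))\<^sup>2 / (2 * \<omega>)"
    unfolding t_def adj using assms(3) norm_square_above_tangent[of "A *v x - b" "A *v y - b"]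
    by (intro divide_right_mono) auto
  then have 2: "(norm (A *v x - b))\<^sup>2 / (2 * \<omega>) + t / \<omega> \<le> (norm (A *v y - b))\<^sup>2 / (2 * \<omega>)"
    by (simp add: add_divide_distrib)
  have "(Q *v x + \<omega> *\<^sub>R x + c + (1 / \<omega>) *\<^sub>R (transpose A *v (A *v x - b))) \<bullet> (y - x)
      = (Q *v x + c) \<bullet> (y - x) + \<omega> * (x \<bullet> (y - x)) + t / \<omega>"
    unfolding t_def by (simp only: inner_add_left inner_scaleR_left) simp
  then show ?thesis
    using 1 2 quad_obj_above_tangent[OF assms(1,2), of c x y]
    unfolding penalized_obj_def by linarith
qed

section \<open>Near-optimality of points near the central path\<close>

text \<open>The Cauchy-Schwarz inequality against the all-ones vector gives the factor \<open>\<surd>(2 n)\<close>, which is at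
  most \<open>3/2 n\<close> because \<open>n \<ge> 1\<close>.\<close>

lemma sum_components_le:
  fixes r3 r4 :: "real ^ 'n"
  shows "(\<Sum>i\<in>UNIV. r3 $ i + r4 $ i) \<le> 3 / 2 * real CARD('n) * norm (r3, r4)"
proof -
  have n: "1 \<le> real CARD('n)"
    using zero_less_card_finite[where 'a = 'n] by linarith
  have "sqrt (2 * real CARD('n)) \<le> 3 / 2 * real CARD('n)"
  proof (rule real_le_lsqrt)
    have "2 * real CARD('n) \<le> 9 / 4 * (real CARD('n) * 1)"
      by simp
    also have "\<dots> \<le> 9 / 4 * (real CARD('n) * real CARD('n))"
      using n by (intro mult_left_mono) auto
    finally show "2 * real CARD('n) \<le> (3 / 2 * real CARD('n))\<^sup>2"
      by (simp add: power2_eq_square)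
  qed simp_all
  moreover have "norm (1 :: real ^ 'n, 1 :: real ^ 'n) = sqrt (2 * real CARD('n))"
    by (simp add: norm_eq_sqrt_inner inner_vec_def)
  ultimately have one: "norm (1 :: real ^ 'n, 1 :: real ^ 'n) \<le> 3 / 2 * real CARD('n)"
    by simp
  have "(\<Sum>i\<in>UNIV. r3 $ i + r4 $ i) = (1, 1) \<bullet> (r3, r4)"
    by (simp add: inner_vec_def sum.distrib)
  also have "\<dots> \<le> norm (1 :: real ^ 'n, 1 :: real ^ 'n) * norm (r3, r4)"
    by (rule norm_cauchy_schwarz)
  also have "\<dots> \<le> 3 / 2 * real CARD('n) * norm (r3, r4)"
    by (intro mult_right_mono one) simp
  finally show ?thesis .
qed

text \<open>Along \<open>y - x\<close>, with \<open>y\<close> in the box, the gradient \<open>\<mu>L - \<mu>R\<close> predicts a decrease of at most the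
  sum of all complementarity products: componentwise,
  \<open>\<mu>L (y - x) = \<mu>L (1 + y) - \<mu>L (1 + x) \<ge> - \<mu>L (1 + x)\<close>, and likewise for \<open>- \<mu>R\<close>.\<close>

lemma multiplier_direction_lower_bound:
  fixes \<mu>L \<mu>R x y r3 r4 :: "real ^ 'n"
  assumes pos: "\<And>i. 0 \<le> \<mu>L $ i" "\<And>i. 0 \<le> \<mu>R $ i"
    and r3: "\<mu>L * (1 + x) - \<tau> *\<^sub>R 1 = r3" and r4: "\<mu>R * (1 - x) - \<tau> *\<^sub>R 1 = r4"
    and y: "infnorm y \<le> 1"
  shows "- (2 * real CARD('n) * \<tau> + (\<Sum>i\<in>UNIV. r3 $ i + r4 $ i)) \<le> (\<mu>L - \<mu>R) \<bullet> (y - x)"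
proof -
  have "- (2 * \<tau> + (r3 $ i + r4 $ i)) \<le> (\<mu>L $ i - \<mu>R $ i) * (y $ i - x $ i)" for i
  proof -
    have "\<bar>y $ i\<bar> \<le> 1"
      using component_le_infnorm_cart[of y i] y by linarith
    then have "0 \<le> \<mu>L $ i * (1 + y $ i)" "0 \<le> \<mu>R $ i * (1 - y $ i)"
      using pos by (auto intro!: mult_nonneg_nonneg)
    moreover have "\<mu>L $ i * (1 + x $ i) = \<tau> + r3 $ i" "\<mu>R $ i * (1 - x $ i) = \<tau> + r4 $ i"
      by (simp_all add: r3[symmetric] r4[symmetric])
    ultimately show ?thesis
      by (simp add: algebra_simps)
  qed
  then have "(\<Sum>i\<in>UNIV. - (2 * \<tau> + (r3 $ i + r4 $ i)))
      \<le> (\<Sum>i\<in>UNIV. (\<mu>L $ i - \<mu>R $ i) * (y $ i - x $ i))"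
    by (intro sum_mono)
  then show ?thesis
    by (simp add: inner_vec_def sum.distrib sum_negf sum_subtractf algebra_simps)
qed

lemma penalized_obj_near_minimal:
  fixes Q :: "real ^ 'n ^ 'n" and A :: "real ^ 'n ^ 'm"
  assumes "transpose Q = Q" and "pos_semidef Q" and "0 < \<omega>" and "0 < \<tau>" and "\<theta> \<le> 0.3"
    and z: "(x, l, \<mu>L, \<mu>R) \<in> central_nbhd Q c A b \<omega> \<theta> \<tau>"
    and y: "infnorm y \<le> 1"
  shows "penalized_obj Q c A b \<omega> x \<le> penalized_obj Q c A b \<omega> y + 5 / 2 * real CARD('n) * \<tau>"
proof -
  obtain r3 r4 where
    dual: "Q *v x + \<omega> *\<^sub>R x + c - transpose A *v l - \<mu>L + \<mu>R = 0" and
    primal: "A *v x - b + \<omega> *\<^sub>R l = 0" and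
    r3: "\<mu>L * (1 + x) - \<tau> *\<^sub>R 1 = r3" and
    r4: "\<mu>R * (1 - x) - \<tau> *\<^sub>R 1 = r4" and
    r: "norm (r3, r4) \<le> \<theta> * \<tau>" and
    pos: "\<And>i. 0 < \<mu>L $ i" "\<And>i. 0 < \<mu>R $ i"
    using z by (auto simp: central_nbhd_def KKT_map_def)
  have "A *v x - b = - (\<omega> *\<^sub>R l)"
    using primal by (simp add: eq_neg_iff_add_eq_0)
  then have penalty_grad: "(1 / \<omega>) *\<^sub>R (transpose A *v (A *v x - b)) = - (transpose A *v l)"
    using assms(3) by (simp add: scaleR_matrix_vector_assoc[symmetric] matrix_vector_mult_scaleR
      linear_neg[OF matrix_vector_mul_linear])
  then have grad: "Q *v x + \<omega> *\<^sub>R x + c + (1 / \<omega>) *\<^sub>R (transpose A *v (A *v x - b)) = \<mu>L - \<mu>R"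
    using dual unfolding penalty_grad by (simp add: algebra_simps)
  have "norm (r3, r4) \<le> 0.3 * \<tau>"
    using r mult_right_mono[OF assms(5), of \<tau>] assms(4) by linarith
  then have "3 / 2 * real CARD('n) * norm (r3, r4) \<le> 3 / 2 * real CARD('n) * (0.3 * \<tau>)"
    by (intro mult_left_mono) auto
  also have "\<dots> \<le> 1 / 2 * (real CARD('n) * \<tau>)"
    using assms(4) by simp
  finally have "(\<Sum>i\<in>UNIV. r3 $ i + r4 $ i) \<le> 1 / 2 * (real CARD('n) * \<tau>)"
    using sum_components_le[of r3 r4] by linarith
  moreover have "- (2 * real CARD('n) * \<tau> + (\<Sum>i\<in>UNIV. r3 $ i + r4 $ i)) \<le> (\<mu>L - \<mu>R) \<bullet> (y - x)"
    by (intro multiplier_direction_lower_bound r3 r4 y less_imp_le pos)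
  ultimately show ?thesis
    using penalized_obj_above_tangent[OF assms(1-3), of c A b x y] unfolding grad by simp
qed

section \<open>Bounds on the box\<close>

lemma norm_le_sqrt_card_if_infnorm_le_1:
  fixes x :: "real ^ 'n"
  assumes "infnorm x \<le> 1"
  shows "norm x \<le> sqrt (real CARD('n))"
proof -
  have "norm x \<le> sqrt (real CARD('n)) * infnorm x"
    using norm_le_infnorm[of x] by simp
  also have "\<dots> \<le> sqrt (real CARD('n)) * 1"
    using assms by (intro mult_left_mono) auto
  finally show ?thesis
    by simp
qed

lemma norm_matrix_vector_le: "norm (A *v x) \<le> spectral_norm A * norm x"
  unfolding spectral_norm_def by (intro onorm matrix_vector_mul_bounded_linear)

lemma spectral_norm_nonneg: "0 \<le> spectral_norm A"
  unfolding spectral_norm_def by (intro onorm_pos_le matrix_vector_mul_bounded_linear)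

lemma abs_quad_obj_le:
  fixes Q :: "real ^ 'n ^ 'n"
  assumes "infnorm x \<le> 1"
  shows "\<bar>quad_obj Q c x\<bar> \<le> spectral_norm Q * real CARD('n) + norm c * sqrt (real CARD('n))"
proof -
  let ?s = "sqrt (real CARD('n))"
  note x = norm_le_sqrt_card_if_infnorm_le_1[OF assms]
  have "\<bar>x \<bullet> (Q *v x)\<bar> \<le> norm x * norm (Q *v x)"
    by (rule Cauchy_Schwarz_ineq2)
  also have "\<dots> \<le> ?s * (spectral_norm Q * ?s)"
    using x norm_matrix_vector_le[of Q x] mult_left_mono[OF x spectral_norm_nonneg[of Q]]
    by (intro mult_mono) auto
  also have "\<dots> = spectral_norm Q * real CARD('n)"
    by simp
  finally have 1: "\<bar>x \<bullet> (Q *v x)\<bar> \<le> spectral_norm Q * real CARD('n)" .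
  have 2: "\<bar>c \<bullet> x\<bar> \<le> norm c * ?s"
    using Cauchy_Schwarz_ineq2[of c x] mult_left_mono[OF x norm_ge_zero[of c]] by linarith
  show ?thesis
    using 1 2 unfolding quad_obj_def by linarith
qed

section \<open>Objective gap and residual of the computed point\<close>

theorem theorem3p4:
  fixes Q :: "real ^ 'n ^ 'n" and c :: "real ^ 'n"
    and A :: "real ^ 'n ^ 'm" and b :: "real ^ 'm"
    and tol \<theta> C\<^sub>q \<omega> \<tau>\<^sub>E \<tau> :: real
    and xstar x \<mu>L \<mu>R :: "real ^ 'n" and l :: "real ^ 'm"
  assumes Q_sym: "transpose Q = Q" and Q_psd: "pos_semidef Q"
    and tol_pos: "0 < tol"
    and xstar: "is_arg_min (quad_obj Q c) (\<lambda>y. norm (A *v y - b) = chi A b \<and> infnorm y \<le> 1) xstar"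
    and theta: "0 < \<theta>" "\<theta> \<le> 0.3"
    and Cq: "0 < C\<^sub>q" "C\<^sub>q \<ge> spectral_norm Q * real CARD('n) + norm c * sqrt (real CARD('n))"
    and omega: "0 < \<omega>"
      "\<omega> \<le> Min {tol / (2 * real CARD('n)), tol\<^sup>2 / (16 * (4 * C\<^sub>q + real CARD('n))), 1}"
    and tauE: "0 < \<tau>\<^sub>E"
      "\<tau>\<^sub>E \<le> tol\<^sup>2 * \<omega> / (48 * real CARD('n) * (max (spectral_norm A) C\<^sub>q)\<^sup>2)"
    and tau: "0 < \<tau>" "\<tau> \<le> \<tau>\<^sub>E"
    and z: "(x, l, \<mu>L, \<mu>R) \<in> central_nbhd Q c A b \<omega> \<theta> \<tau>"
  shows "x \<in> Omega \<and> quad_obj Q c x \<le> quad_obj Q c xstar + tol \<and> norm (A *v x - b) \<le> chi A b + tol"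
proof -
  define n where "n = real CARD('n)"
  define \<epsilon> where "\<epsilon> = 5 / 2 * n * \<tau>"
  define M where "M = max (spectral_norm A) C\<^sub>q"
  have n: "1 \<le> n"
    unfolding n_def using zero_less_card_finite[where 'a = 'n] by linarith
  have \<omega>: "\<omega> \<le> tol / (2 * n)" "\<omega> \<le> tol\<^sup>2 / (16 * (4 * C\<^sub>q + n))" "\<omega> \<le> 1"
    using omega(2) by (auto simp: n_def)
  have \<omega>_n: "\<omega> * n \<le> tol / 2"
    using \<omega>(1) n by (simp add: field_simps)
  have \<omega>_Cq: "\<omega> * (4 * C\<^sub>q + n) \<le> tol\<^sup>2 / 16"
    using \<omega>(2) n Cq(1) by (simp add: pos_le_divide_eq algebra_simps)
  have M: "0 < M" "C\<^sub>q \<le> M" "spectral_norm A \<le> M"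
    using Cq(1) by (auto simp: M_def)
  have "\<tau> \<le> tol\<^sup>2 * \<omega> / (48 * n * M\<^sup>2)"
    using tau(2) tauE(2) by (simp add: n_def M_def)
  then have \<tau>_M: "48 * (n * \<tau>) * M\<^sup>2 \<le> tol\<^sup>2 * \<omega>"
    using n M(1) by (simp add: pos_le_divide_eq algebra_simps)
  \<comment> \<open>The form in which the bound on \<open>\<tau>\<close> is used, with \<open>k = 1\<close> and \<open>k = n\<close>.\<close>
  have \<epsilon>_bound: "\<epsilon> \<le> k * \<omega> / 4" if "tol\<^sup>2 \<le> 4 * k * M\<^sup>2" "0 \<le> k" for k
  proof -
    have "48 * (n * \<tau>) * M\<^sup>2 \<le> 4 * k * M\<^sup>2 * \<omega>"
      using \<tau>_M mult_right_mono[OF that(1) less_imp_le[OF omega(1)]] by linarith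
    then have "(48 * (n * \<tau>)) * M\<^sup>2 \<le> (4 * (k * \<omega>)) * M\<^sup>2"
      by (simp add: algebra_simps)
    then have "48 * (n * \<tau>) \<le> 4 * (k * \<omega>)"
      using M(1) by (simp only: mult_le_cancel_right_pos zero_less_power)
    moreover have "0 \<le> k * \<omega>"
      using that(2) omega(1) by simp
    ultimately show ?thesis
      unfolding \<epsilon>_def by linarith
  qed
  have xs: "norm (A *v xstar - b) = chi A b" "infnorm xstar \<le> 1"
    using xstar by (auto simp: is_arg_min_def)
  have x1: "infnorm x < 1"
    using z by (auto simp: central_nbhd_def)
  then have x_Omega: "x \<in> Omega"
    by (simp add: Omega_def)
  have chi_le_x: "chi A b \<le> norm (A *v x - b)"
    using x_Omega closure_subset by (intro chi_le) blast
  have chi_nonneg: "0 \<le> chi A b"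
    using xs(1) norm_ge_zero[of "A *v xstar - b"] by linarith
  have abs_q: "\<bar>quad_obj Q c x\<bar> \<le> C\<^sub>q" "\<bar>quad_obj Q c xstar\<bar> \<le> C\<^sub>q"
    using abs_quad_obj_le[of x Q c] abs_quad_obj_le[of xstar Q c] xs(2) x1 Cq(2) by linarith+
  have norm_le: "norm x \<le> sqrt n" "norm xstar \<le> sqrt n"
    unfolding n_def using x1 xs(2) by (auto intro: norm_le_sqrt_card_if_infnorm_le_1)
  have "(norm xstar)\<^sup>2 \<le> n"
    using power_mono[OF norm_le(2), of 2] n by simp
  then have "\<omega> / 2 * (norm xstar)\<^sup>2 \<le> \<omega> / 2 * n"
    using omega(1) by (intro mult_left_mono) auto
  moreover have "0 \<le> \<omega> / 2 * (norm x)\<^sup>2"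
    using omega(1) by simp
  moreover have "penalized_obj Q c A b \<omega> x \<le> penalized_obj Q c A b \<omega> xstar + \<epsilon>"
    unfolding \<epsilon>_def n_def
    by (rule penalized_obj_near_minimal[OF Q_sym Q_psd omega(1) tau(1) theta(2) z xs(2)])
  ultimately have main: "quad_obj Q c x + (norm (A *v x - b))\<^sup>2 / (2 * \<omega>)
      \<le> quad_obj Q c xstar + (chi A b)\<^sup>2 / (2 * \<omega>) + \<omega> / 2 * n + \<epsilon>"
    unfolding penalized_obj_def xs(1) by linarith
  have objective: "quad_obj Q c x \<le> quad_obj Q c xstar + tol"
  proof (cases "2 * C\<^sub>q \<le> tol")
    case True
    then show ?thesis
      using abs_q by linarith
  next
    case False
    then have "tol\<^sup>2 \<le> (2 * M)\<^sup>2"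
      using tol_pos M(2) by (intro power_mono) auto
    then have "\<epsilon> \<le> \<omega> / 4"
      using \<epsilon>_bound[of 1] by (simp add: power_mult_distrib)
    moreover have "\<omega> * 1 \<le> \<omega> * n"
      using n omega(1) by (intro mult_left_mono) auto
    moreover have "(chi A b)\<^sup>2 / (2 * \<omega>) \<le> (norm (A *v x - b))\<^sup>2 / (2 * \<omega>)"
      using omega(1) chi_le_x chi_nonneg by (intro divide_right_mono power_mono) auto
    ultimately show ?thesis
      using main \<omega>_n tol_pos by linarith
  qed
  have residual: "norm (A *v x - b) \<le> chi A b + tol"
  proof (cases "2 * sqrt n * spectral_norm A \<le> tol")
    case True
    have "norm (A *v x - b) \<le> norm (A *v xstar - b) + norm (A *v (x - xstar))"
      using norm_triangle_ineq[of "A *v xstar - b" "A *v (x - xstar)"]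
      by (simp add: matrix_vector_mult_diff_distrib)
    moreover have "norm (A *v (x - xstar)) \<le> spectral_norm A * (2 * sqrt n)"
    proof -
      have "norm (x - xstar) \<le> 2 * sqrt n"
        using norm_triangle_ineq4[of x xstar] norm_le by linarith
      then have "spectral_norm A * norm (x - xstar) \<le> spectral_norm A * (2 * sqrt n)"
        by (intro mult_left_mono spectral_norm_nonneg)
      then show ?thesis
        using norm_matrix_vector_le[of A "x - xstar"] by linarith
    qed
    ultimately show ?thesis
      using True xs(1) by (simp add: mult.commute)
  next
    case False
    have "2 * sqrt n * spectral_norm A \<le> 2 * sqrt n * M"
      using M(3) n by (intro mult_left_mono) auto
    then have "tol\<^sup>2 \<le> (2 * sqrt n * M)\<^sup>2"
      using False tol_pos by (intro power_mono) auto
    then have \<epsilon>: "\<epsilon> \<le> n * \<omega> / 4"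
      using \<epsilon>_bound[of n] n by (simp add: power_mult_distrib)
    have "0 \<le> n * \<omega>" "\<omega> / 2 * n = n * \<omega> / 2"
      using n omega(1) by simp_all
    then have "(norm (A *v x - b))\<^sup>2 / (2 * \<omega>) \<le> (chi A b)\<^sup>2 / (2 * \<omega>) + (2 * C\<^sub>q + n * \<omega>)"
      using main abs_q \<epsilon> by linarith
    then have "2 * \<omega> * ((norm (A *v x - b))\<^sup>2 / (2 * \<omega>))
        \<le> 2 * \<omega> * ((chi A b)\<^sup>2 / (2 * \<omega>) + (2 * C\<^sub>q + n * \<omega>))"
      using omega(1) by (intro mult_left_mono) auto
    then have "(norm (A *v x - b))\<^sup>2 \<le> (chi A b)\<^sup>2 + \<omega> * (4 * C\<^sub>q + 2 * (n * \<omega>))"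
      using omega(1) by (simp add: distrib_left)
    moreover have "\<omega> * (4 * C\<^sub>q + 2 * (n * \<omega>)) \<le> \<omega> * (8 * C\<^sub>q + 2 * n)"
    proof (rule mult_left_mono)
      have "n * \<omega> \<le> n"
        using n by (intro mult_left_le \<omega>(3)) auto
      then show "4 * C\<^sub>q + 2 * (n * \<omega>) \<le> 8 * C\<^sub>q + 2 * n"
        using Cq(1) by linarith
    qed (use omega(1) in simp)
    moreover have "\<omega> * (8 * C\<^sub>q + 2 * n) = 2 * (\<omega> * (4 * C\<^sub>q + n))"
      by (simp add: algebra_simps)
    ultimately have "(norm (A *v x - b))\<^sup>2 \<le> (chi A b)\<^sup>2 + tol\<^sup>2"
      using \<omega>_Cq zero_le_power2[of tol] by linarith
    also have "\<dots> \<le> (chi A b + tol)\<^sup>2"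
      using chi_nonneg tol_pos by (simp add: power2_sum)
    finally show ?thesis
      by (rule power2_le_imp_le) (use chi_nonneg tol_pos in simp)
  qed
  show ?thesis
    using x_Omega objective residual by blast
qed

end
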